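(* There is no finite non-trivial group $G$ such that $\mathcal{CD}(G)=L(G)$.
   Context: For a finite group $G$, $L(G)$ denotes the lattice of all subgroups of $G$. The Chermak-Delgado measure of a subgroup $H\le G$ is $m_G(H)=|H|\,|C_G(H)|$, where $C_G(H)$ is the centralizer of $H$ in $G$. Put $m(G)=\max\{m_G(H)\mid H\le G\}$ and $\mathcal{CD}(G)=\{H\le G\mid m_G(H)=m(G)\}$ (the Chermak-Delgado lattice of $G$). *)

theory Defs
  imports "HOL-Algebra.Algebra"
begin

definition subgroup_lattice :: "('a, 'b) monoid_scheme \<Rightarrow> 'a set set"
  where "subgroup_lattice G = {H. subgroup H G}"

definition centralizer :: "('a, 'b) monoid_scheme \<Rightarrow> 'a set \<Rightarrow> 'a set"
  where "centralizer G H = {g \<in> carrier G. \<forall>h\<in>H. g \<otimes>\<^bsub>G\<^esub> h = h \<otimes>\<^bsub>G\<^esub> g}"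

definition cd_measure :: "('a, 'b) monoid_scheme \<Rightarrow> 'a set \<Rightarrow> nat"
  where "cd_measure G H = card H * card (centralizer G H)"

text \<open>Intended for finite groups: \<open>card\<close> of an infinite set is 0, and \<open>Max\<close> of an infinite
  set is unspecified.\<close>

definition max_cd_measure :: "('a, 'b) monoid_scheme \<Rightarrow> nat"
  where "max_cd_measure G = Max (cd_measure G ` subgroup_lattice G)"

text \<open>Both \<open>subgroup_lattice G\<close> and \<open>chermak_delgado_lattice G\<close> are represented by their
  sets of elements; the order on each is inclusion, so equality of the lattices is equality of
  these sets.\<close>

definition chermak_delgado_lattice :: "('a, 'b) monoid_scheme \<Rightarrow> 'a set set"
  where "chermak_delgado_lattice G =
    {H \<in> subgroup_lattice G. cd_measure G H = max_cd_measure G}"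

end

theory Submission
  imports Defs
begin

text \<open>
  If every subgroup attains the maximal measure, then in particular every subgroup has the measure
  of the trivial one, so the orders of \<open>H\<close> and of its centralizer always multiply to the order of
  the group. A Sylow subgroup \<open>P\<close> of a non-trivial group violates this, for a prime \<open>p\<close> dividing the
  group order: the product formula forces the order of its centralizer to be the index of \<open>P\<close>, which
  is prime to \<open>p\<close>. But that centralizer is the set of fixed points of \<open>P\<close> acting on the whole group
  by conjugation, and a \<open>p\<close>-group acting on a finite set whose size is divisible by \<open>p\<close> has a number
  of fixed points divisible by \<open>p\<close> (\<open>prime_dvd_card_fixed_points\<close>).
\<close>

text \<open>
  The points that are moved fall into orbits with more than one element, and the size of each such
  orbit divides the group order, a power of \<open>p\<close>; so the number of moved points is divisible by \<open>p\<close>.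
\<close>

lemma (in group_action) prime_dvd_card_fixed_points:
  fixes p :: nat
  assumes p: "Factorial_Ring.prime p" and order: "order G = p ^ a"
    and fin: "finite E" and dvd: "p dvd card E"
  shows "p dvd card {x \<in> E. \<forall>g \<in> carrier G. \<phi> g x = x}"
proof -
  define F where "F = {x \<in> E. \<forall>g \<in> carrier G. \<phi> g x = x}"
  have fixed_orbit: "orbit G \<phi> x = {x}" if "x \<in> F" for x
    using that orbit_refl[of x] by (auto simp: F_def orbit_def)
  \<comment> \<open>Moved points are counted by an indicator sum so that the count splits over the orbits.\<close>
  have dvd_orbit: "p dvd (\<Sum>x\<in>A. if x \<in> F then 0 else 1 :: nat)" if A: "A \<in> orbits G E \<phi>" for A
  proof -
    obtain x where x: "x \<in> E" "A = orbit G \<phi> x"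
      using A by (auto simp: orbits_def)
    have sub: "A \<subseteq> E"
      using A orbits_coverture by blast
    show ?thesis
    proof (cases "x \<in> F")
      case True
      then show ?thesis by (simp add: x fixed_orbit)
    next
      case False
      \<comment> \<open>An orbit containing a fixed point consists of that point alone.\<close>
      have moved: "y \<notin> F" if "y \<in> A" for y
      proof
        assume "y \<in> F"
        moreover have "x \<in> orbit G \<phi> y"
          using orbit_sym x sub that by blast
        ultimately show False using fixed_orbit[of y] False by simp
      qed
      have "card A dvd p ^ a"
        using orbit_stabilizer_theorem[OF x(1)] order x(2) by (metis dvd_triv_left)
      moreover have "card A \<noteq> 1"
      proof
        assume "card A = 1"
        then have "A = {x}"
          using orbit_refl[OF x(1)] x(2) by (auto simp: card_1_singleton_iff)
        then have "\<phi> g x = x" if "g \<in> carrier G" for g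
          using that x(2) by (auto simp: orbit_def)
        then show False using False x(1) by (auto simp: F_def)
      qed
      ultimately have "p dvd card A"
        using p by (auto simp: divides_primepow_nat)
      moreover have "(\<Sum>x\<in>A. if x \<in> F then 0 else 1 :: nat) = card A"
        using moved by simp
      ultimately show ?thesis by simp
    qed
  qed
  have "(\<Sum>x\<in>E. if x \<in> F then 0 else 1 :: nat) = card (E - F)"
    using fin by (simp add: sum.If_cases Diff_eq)
  moreover have "p dvd (\<Sum>A\<in>orbits G E \<phi>. \<Sum>x\<in>A. if x \<in> F then 0 else 1 :: nat)"
    by (rule dvd_sum) (rule dvd_orbit)
  ultimately have "p dvd card (E - F)"
    by (simp only: disjoint_sum[OF fin])
  moreover have "card E = card F + card (E - F)"
    using card_Un_disjoint[of F "E - F"] fin by (auto simp: F_def Un_absorb1 Collect_conj_eq)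
  ultimately show ?thesis
    using dvd by (simp add: F_def[symmetric] dvd_add_left_iff)
qed

text \<open>The centralizer of \<open>P\<close> is the fixed-point set of \<open>P\<close> acting on the whole group by
  conjugation.\<close>

lemma (in group) prime_dvd_card_centralizer:
  fixes p :: nat
  assumes "Factorial_Ring.prime p" and P: "subgroup P G" and "card P = p ^ a"
    and "finite (carrier G)" and "p dvd order G"
  shows "p dvd card (centralizer G P)"
proof -
  let ?conj = "\<lambda>g. \<lambda>h \<in> carrier G. g \<otimes> h \<otimes> inv g"
  interpret group_action "G\<lparr>carrier := P\<rparr>" "carrier G" ?conj
    using group_action.induced_action[OF action_by_conjugation P] .
  have fixed: "?conj g x = x \<longleftrightarrow> x \<otimes> g = g \<otimes> x" if "g \<in> P" "x \<in> carrier G" for g x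
    using that subgroup.mem_carrier[OF P] by (auto simp: inv_solve_right')
  then have "{x \<in> carrier G. \<forall>g\<in>P. ?conj g x = x} = centralizer G P"
    unfolding centralizer_def by blast
  then show ?thesis
    using prime_dvd_card_fixed_points[of p a] assms by (simp add: order_def)
qed

theorem corollary3:
  shows "\<not> (\<exists>G :: ('a, 'b) monoid_scheme.
           group G \<and> finite (carrier G) \<and> carrier G \<noteq> {\<one>\<^bsub>G\<^esub>} \<and>
           chermak_delgado_lattice G = subgroup_lattice G)"
proof
  assume "\<exists>G :: ('a, 'b) monoid_scheme.
           group G \<and> finite (carrier G) \<and> carrier G \<noteq> {\<one>\<^bsub>G\<^esub>} \<and>
           chermak_delgado_lattice G = subgroup_lattice G"
  then obtain G :: "('a, 'b) monoid_scheme" where G: "group G" and fin: "finite (carrier G)"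
    and nontriv: "carrier G \<noteq> {\<one>\<^bsub>G\<^esub>}"
    and CD: "chermak_delgado_lattice G = subgroup_lattice G"
    by blast
  interpret group G by (fact G)
  have max: "cd_measure G H = max_cd_measure G" if "subgroup H G" for H
    using that CD by (auto simp: chermak_delgado_lattice_def subgroup_lattice_def)
  have "centralizer G {\<one>\<^bsub>G\<^esub>} = carrier G"
    by (auto simp: centralizer_def)
  then have "max_cd_measure G = order G"
    using max[OF triv_subgroup] by (simp add: cd_measure_def order_def)
  then have product: "card H * card (centralizer G H) = order G" if "subgroup H G" for H
    using max[OF that] by (simp add: cd_measure_def)
  have pos: "order G > 0"
    using fin order_gt_0_iff_finite by blast
  have "order G \<noteq> 1"
    using nontriv one_closed unfolding order_def by (metis card_1_singletonE singletonD)
  then obtain p where p: "Factorial_Ring.prime p" "p dvd order G"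
    using prime_factor_nat by blast
  obtain a m where m: "order G = p ^ a * m" "\<not> p dvd m"
    using multiplicity_decompose'[of "order G" p] pos p
    by (metis neq0_conv not_prime_unit)
  obtain P where P: "subgroup P G" "card P = p ^ a"
    using sylow_thm[OF p(1) G m(1) fin] by blast
  have "card (centralizer G P) = m"
    using product[OF P(1)] P(2) m(1) p(1) by (simp add: prime_gt_0_nat)
  then show False
    using prime_dvd_card_centralizer[OF p(1) P fin p(2)] m(2) by simp
qed

end
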